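(* There exists a $(280_4,112_{10})$-configuration on $X$: the Fermat quartic surface $X$ in characteristic $3$ has $280$ ${\bf F}_9$-rational points and $112$ lines such that each of the $112$ lines contains exactly $10$ of the $280$ points and each of the $280$ points lies on exactly $4$ of the $112$ lines.
   Context: $X$ is the Fermat quartic surface $x_0^4+x_1^4+x_2^4+x_3^4=0$ in ${\bf P}^3$ over an algebraically closed field of characteristic $3$; it is (isomorphic to) the supersingular $K3$ surface with Artin invariant $1$ in characteristic $3$. It is known that $X$ contains exactly $112$ lines. A $(280_4,112_{10})$-configuration on $X$ is the relation between these $112$ lines and the $280$ ${\bf F}_9$-rational points of $X$ in which every point is on $4$ lines and every line contains $10$ points. *)

theory Defs
  imports "HOL-Analysis.Analysis" "HOL-Computational_Algebra.Computational_Algebra"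
begin

(* P^3 over a field is modelled by the linear subspaces of the four-dimensional coordinate space:
   points are the subspaces of dimension 1, lines those of dimension 2, and a point lies on a line
   iff it is a subset of it. *)

definition proj_points :: "('a::field ^ 4) set set" where
  "proj_points = {P. vec.subspace P \<and> vec.dim P = 1}"

definition proj_lines :: "('a::field ^ 4) set set" where
  "proj_lines = {L. vec.subspace L \<and> vec.dim L = 2}"

(* The index type 4 consists of the residues 0, 1, 2, 3, so the sum is x_0^4 + x_1^4 + x_2^4 + x_3^4.
   As the equation is homogeneous, it holds for all v in P iff it holds for one nonzero v in P. *)

definition fermat_quartic :: "('a::field ^ 4) set set" where
  "fermat_quartic = {P \<in> proj_points. \<forall>v\<in>P. (\<Sum>i\<in>UNIV. (v $ i) ^ 4) = 0}"

definition fermat_lines :: "('a::field ^ 4) set set" where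
  "fermat_lines = {L \<in> proj_lines. \<forall>P\<in>proj_points. P \<subseteq> L \<longrightarrow> P \<in> fermat_quartic}"

(* In an algebraically closed field of characteristic 3, the roots of T^9 - T form the unique
   subfield with nine elements. *)

definition F9 :: "'a::field set" where
  "F9 = {x. x ^ 9 = x}"

definition F9_rational :: "('a::field ^ 4) set \<Rightarrow> bool" where
  "F9_rational P \<longleftrightarrow> (\<exists>v\<in>P. v \<noteq> 0 \<and> (\<forall>i. v $ i \<in> F9))"

definition fermat_F9_points :: "('a::field ^ 4) set set" where
  "fermat_F9_points = {P \<in> fermat_quartic. F9_rational P}"

end

theory Submission
  imports Defs
begin

text \<open>
  In characteristic 3 cubing is additive, so the quartic form is the value \<open>h(x, x)\<close> of
  \<open>h(x, y) = \<Sum> x\<^sub>i y\<^sub>i\<^sup>3\<close>, which is linear in \<open>x\<close> and Frobenius-linear in \<open>y\<close>: the form of a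
  Hermitian surface over the field with 9 elements, where \<open>x \<mapsto> x\<^sup>3\<close> is the conjugation and
  \<open>x \<mapsto> x\<^sup>4\<close> is the norm to the field with 3 elements. Since the ground field is algebraically
  closed, the Hermitian theory has to be combined with the fact that all lines are defined over
  the field with 9 elements.

  Points: the norm takes the values 0, 1, -1 respectively 1, 4, 4 times. Adding norms over pairs of
  coordinates, 33 pairs have sum 0 and 24 pairs each of the sums 1 and -1, so there are
  \<open>33\<^sup>2 + 2 * 24\<^sup>2 - 1 = 2240\<close> nonzero isotropic vectors, and \<open>2240 / 8 = 280\<close> points.

  Points on a line: a line in the surface is a plane \<open>L\<close> on which \<open>h\<close> vanishes identically
  (\<open>fermat_line_isotropic\<close>). The equations that this imposes on a reduced echelon basis of \<open>L\<close>,
  together with their cubes, show that \<open>a\<close> and \<open>a\<^sup>9\<close> solve the same regular linear system for each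
  entry \<open>a\<close>; so the basis is rational (\<open>fermat_line_F9_basis\<close>), and \<open>L\<close> has as many rational points
  as the projective line, namely 10.

  Lines through a rational point \<open>p\<close>: they lie in the orthogonal space of \<open>p\<close>. This space is spanned by
  \<open>p\<close> and two orthogonal vectors of opposite nonzero norms, so a line through \<open>p\<close> is given by a ratio
  \<open>a : b\<close> with \<open>a\<^sup>4 = b\<^sup>4\<close>, which leaves 4 lines (\<open>card_fermat_lines_through_point\<close>).

  Counting incidences in two ways now gives \<open>280 * 4 / 10 = 112\<close> lines.
\<close>

section \<open>Points and lines as spans\<close>

lemma span_single_iff: "x \<in> vec.span {v} \<longleftrightarrow> (\<exists>c. x = c *s v)"
  for v :: "'a::field ^ 'n"
  by (auto simp: vec.span_singleton)

lemma span_pair_iff: "x \<in> vec.span {u, v} \<longleftrightarrow> (\<exists>a b. x = a *s u + b *s v)"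
  for u v :: "'a::field ^ 'n"
proof -
  have "x \<in> vec.span {u, v} \<longleftrightarrow> (\<exists>a b. x - a *s u = b *s v)"
    by (simp add: vec.span_breakdown_eq span_single_iff)
  then show ?thesis by (simp add: algebra_simps)
qed

lemma span_single_subset_iff:
  "vec.subspace L \<Longrightarrow> vec.span {v} \<subseteq> L \<longleftrightarrow> v \<in> L" for v :: "'a::field ^ 'n"
  by (metis empty_subsetI insert_subset vec.span_base insertI1 subsetD vec.span_minimal)

lemma span_scale_single: "c \<noteq> 0 \<Longrightarrow> vec.span {c *s v} = vec.span {v}"
  for v :: "'a::field ^ 'n"
proof -
  assume "c \<noteq> 0"
  then have "v = inverse c *s (c *s v)" by simp
  then have "v \<in> vec.span {c *s v}" "c *s v \<in> vec.span {v}" by (auto simp: span_single_iff)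
  then show ?thesis by (intro subset_antisym) (simp_all add: span_single_subset_iff)
qed

lemma proj_points_iff: "P \<in> proj_points \<longleftrightarrow> (\<exists>v. v \<noteq> 0 \<and> P = vec.span {v})"
proof
  assume "P \<in> proj_points"
  then have P: "vec.subspace P" "vec.dim P = 1" by (auto simp: proj_points_def)
  obtain B where B: "B \<subseteq> P" "vec.independent B" "P \<subseteq> vec.span B" "card B = vec.dim P"
    by (rule vec.basis_exists)
  from B(4) P(2) obtain v where v: "B = {v}" by (metis card_1_singletonE)
  with B(2) have "v \<noteq> 0" by (simp add: vec.dependent_single)
  moreover have "P = vec.span {v}"
    using B(1,3) P(1) v span_single_subset_iff[of P v] by auto
  ultimately show "\<exists>v. v \<noteq> 0 \<and> P = vec.span {v}" by blast
next
  assume "\<exists>v. v \<noteq> 0 \<and> P = vec.span {v}"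
  then show "P \<in> proj_points"
    by (auto simp: proj_points_def vec.dim_insert)
qed

lemma span_pair_proj_lines:
  "u \<noteq> 0 \<Longrightarrow> v \<notin> vec.span {u} \<Longrightarrow> vec.span {u, v} \<in> proj_lines"
  by (subst insert_commute) (auto simp: proj_lines_def vec.dim_insert)

lemma proj_line_eq_span:
  assumes "L \<in> proj_lines" "u \<in> L" "v \<in> L" "u \<noteq> 0" "v \<notin> vec.span {u}"
  shows "L = vec.span {u, v}"
proof -
  from assms(1) have L: "vec.subspace L" "vec.dim L = 2" by (auto simp: proj_lines_def)
  have "vec.dim (vec.span {u, v}) = 2"
    using span_pair_proj_lines[OF assms(4,5)] by (simp add: proj_lines_def)
  moreover have "vec.span {u, v} \<subseteq> L" using assms L by (simp add: vec.span_minimal)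
  ultimately show ?thesis
    using vec.subspace_dim_equal[OF vec.subspace_span L(1), of "{u, v}"] L(2) by simp
qed

lemma proj_line_obtain_second:
  assumes "L \<in> proj_lines"
  obtains q where "q \<in> L" "q \<notin> vec.span {p}"
proof -
  have "\<not> L \<subseteq> vec.span {p}"
  proof
    assume "L \<subseteq> vec.span {p}"
    then have "vec.dim L \<le> card {p}" by (rule vec.dim_le_card) simp
    with assms show False by (simp add: proj_lines_def)
  qed
  with that show thesis by blast
qed

text \<open>
  Such a basis makes coordinates on \<open>L\<close> visible: a vector of \<open>L\<close> is determined by its entries at \<open>i\<close>
  and \<open>j\<close>, which are its coefficients. Rationality can therefore be read off from the entries.
\<close>

lemma proj_line_echelon_basis:
  fixes L :: "('a::field ^ 4) set"
  assumes "L \<in> proj_lines"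
  obtains u v :: "'a ^ 4" and i j where "L = vec.span {u, v}" "i \<noteq> j"
    "u $ i = 1" "u $ j = 0" "v $ i = 0" "v $ j = 1"
proof -
  from assms have L: "vec.subspace L" by (simp add: proj_lines_def)
  obtain x where x: "x \<in> L" "x \<notin> vec.span {0}" by (rule proj_line_obtain_second[OF assms])
  then have "x \<noteq> 0" by (metis vec.span_zero)
  then obtain i where i: "x $ i \<noteq> 0" by (auto simp: vec_eq_iff)
  define u where "u = inverse (x $ i) *s x"
  have u: "u \<in> L" "u $ i = 1" using i x L by (auto simp: u_def vec.subspace_scale)
  obtain y where y: "y \<in> L" "y \<notin> vec.span {u}" by (rule proj_line_obtain_second[OF assms])
  define z where "z = y - (y $ i) *s u"
  have z: "z \<in> L" "z $ i = 0" using y u L by (auto simp: z_def vec.subspace_scale vec.subspace_diff)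
  have "z \<noteq> 0" using y(2) by (auto simp: z_def span_single_iff)
  then obtain j where j: "z $ j \<noteq> 0" by (auto simp: vec_eq_iff)
  define v where "v = inverse (z $ j) *s z"
  define w where "w = u - (u $ j) *s v"
  have v: "v \<in> L" "v $ i = 0" "v $ j = 1" using j z L by (auto simp: v_def vec.subspace_scale)
  have w: "w \<in> L" "w $ i = 1" "w $ j = 0"
    using u v L by (auto simp: w_def vec.subspace_scale vec.subspace_diff)
  have "w \<noteq> 0" using w(2) by auto
  moreover have "v \<notin> vec.span {w}" using v w by (auto simp: span_single_iff)
  ultimately have "L = vec.span {w, v}" using proj_line_eq_span[OF assms w(1) v(1)] by blast
  moreover have "i \<noteq> j" using v by auto
  ultimately show thesis using that v w by blast
qed


section \<open>The Hermitian form\<close>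

definition herm :: "'a::field ^ 4 \<Rightarrow> 'a ^ 4 \<Rightarrow> 'a" where
  "herm x y = (\<Sum>i\<in>UNIV. x $ i * (y $ i) ^ 3)"

lemma fermat_form_eq_herm: "(\<Sum>i\<in>UNIV. (v $ i) ^ 4) = herm v v"
  by (simp add: herm_def eval_nat_numeral)

lemma herm_add_left: "herm (x + y) z = herm x z + herm y z"
  by (simp add: herm_def sum.distrib algebra_simps)

lemma herm_scale_left: "herm (c *s x) z = c * herm x z"
  by (simp add: herm_def sum_distrib_left algebra_simps)

lemma herm_scale_right: "herm x (c *s z) = c ^ 3 * herm x z"
  by (simp add: herm_def sum_distrib_left algebra_simps power_mult_distrib)

text \<open>
  The two distinguished indices of an echelon basis, or of a splitting of the form into two binary
  ones, can be any two; completing them to all four allows one computation for every case.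
\<close>

lemma index_complement_pair:
  assumes "i \<noteq> (j :: 4)"
  obtains k l where "distinct [i, j, k, l]" "UNIV = {i, j, k, l}"
proof -
  have "card (UNIV - {i, j}) = 2" using assms by (simp add: card_Diff_subset)
  then obtain k l where kl: "UNIV - {i, j} = {k, l}" "k \<noteq> l" by (auto simp: card_2_iff)
  then have "k \<notin> {i, j}" "l \<notin> {i, j}" by blast+
  moreover have "UNIV = {i, j, k, l}" using kl(1) by blast
  ultimately show thesis using that[of k l] kl(2) assms by auto
qed

lemma herm_expand:
  fixes x y :: "'a::field ^ 4"
  assumes "distinct [i, j, k, l]" "UNIV = {i, j, k, l :: 4}"
  shows "herm x y = x $ i * (y $ i) ^ 3 + x $ j * (y $ j) ^ 3
                  + x $ k * (y $ k) ^ 3 + x $ l * (y $ l) ^ 3"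
  using assms(1) unfolding herm_def by (subst assms(2)) (simp add: add.assoc)

definition isotropic_F9 :: "('a::field ^ 4) set" where
  "isotropic_F9 = {v. v \<noteq> 0 \<and> (\<forall>i. v $ i \<in> F9) \<and> herm v v = 0}"

text \<open>
  The form only needs to vanish at one spanning vector, because \<open>h(c x, c x) = c\<^sup>4 h(x, x)\<close>.
\<close>

lemma fermat_F9_points_eq: "fermat_F9_points = (\<lambda>v. vec.span {v}) ` isotropic_F9"
proof (intro equalityI subsetI)
  fix P :: "('a ^ 4) set" assume "P \<in> fermat_F9_points"
  then obtain v :: "'a ^ 4" where P: "P \<in> proj_points" "\<forall>v\<in>P. herm v v = 0"
    and v: "v \<in> P" "v \<noteq> 0" "\<forall>i. v $ i \<in> F9"
    by (auto simp: fermat_F9_points_def fermat_quartic_def F9_rational_def fermat_form_eq_herm)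
  from P(1) obtain w where w: "P = vec.span {w}" by (auto simp: proj_points_iff)
  with v obtain c where c: "v = c *s w" by (auto simp: span_single_iff)
  with v(2) have c0: "c \<noteq> 0" by auto
  then have "P = vec.span {v}" by (simp add: w c span_scale_single)
  then show "P \<in> (\<lambda>v. vec.span {v}) ` isotropic_F9" using v P by (auto simp: isotropic_F9_def)
next
  fix P :: "('a ^ 4) set" assume "P \<in> (\<lambda>v. vec.span {v}) ` isotropic_F9"
  then obtain v :: "'a ^ 4" where v: "P = vec.span {v}" "v \<noteq> 0" "\<forall>i. v $ i \<in> F9" "herm v v = 0"
    by (auto simp: isotropic_F9_def)
  have "\<forall>x\<in>P. herm x x = 0"
    by (auto simp: v(1) span_single_iff herm_scale_left herm_scale_right v(4))
  moreover have "v \<in> P" by (simp add: v(1) vec.span_base)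
  ultimately show "P \<in> fermat_F9_points" using v
    by (auto simp: fermat_F9_points_def fermat_quartic_def F9_rational_def fermat_form_eq_herm
        proj_points_iff)
qed

lemma fermat_lines_iff: "L \<in> fermat_lines \<longleftrightarrow> L \<in> proj_lines \<and> (\<forall>x\<in>L. herm x x = 0)"
proof (intro iffI conjI ballI)
  assume L: "L \<in> fermat_lines"
  then show "L \<in> proj_lines" by (simp add: fermat_lines_def)
  fix x assume x: "x \<in> L"
  show "herm x x = 0"
  proof (cases "x = 0")
    case True then show ?thesis by (simp add: herm_def)
  next
    case False
    then have "vec.span {x} \<in> proj_points" by (auto simp: proj_points_iff)
    moreover have "vec.span {x} \<subseteq> L"
      using x \<open>L \<in> proj_lines\<close> by (simp add: span_single_subset_iff proj_lines_def)
    ultimately have "vec.span {x} \<in> fermat_quartic" using L by (auto simp: fermat_lines_def)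
    then show ?thesis by (auto simp: fermat_quartic_def fermat_form_eq_herm vec.span_base)
  qed
qed (auto simp: fermat_lines_def fermat_quartic_def fermat_form_eq_herm)


section \<open>The field with nine elements and its norm\<close>

text \<open>
  The number of representations of \<open>c\<close> as a sum is the convolution of the two fibre sizes. It serves
  for passing from one coordinate to two, and from two to four.
\<close>

lemma card_add_fibres:
  fixes f :: "'b \<Rightarrow> 'g::ab_group_add"
  assumes "finite A" "finite B" "finite D" "\<And>a. a \<in> A \<Longrightarrow> f a \<in> D"
  shows "card {(a, b) \<in> A \<times> B. f a + g b = c}
    = (\<Sum>d\<in>D. card {a \<in> A. f a = d} * card {b \<in> B. g b = c - d})"
proof -
  have "{(a, b) \<in> A \<times> B. f a + g b = c} = (\<Union>d\<in>D. {a \<in> A. f a = d} \<times> {b \<in> B. g b = c - d})"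
    using assms(4) by (auto simp: algebra_simps)
  also have "card \<dots> = (\<Sum>d\<in>D. card ({a \<in> A. f a = d} \<times> {b \<in> B. g b = c - d}))"
    using assms by (intro card_UN_disjoint) auto
  finally show ?thesis by (simp add: card_cartesian_product)
qed

context
  assumes char3: "CHAR('a::alg_closed_field) = 3"
begin

lemma three_eq_0: "(3 :: 'a) = 0"
  using of_nat_CHAR[where ?'a='a] by (simp add: char3)

lemma one_plus_one: "1 + 1 = (- 1 :: 'a)"
proof -
  have "(1 :: 'a) + 1 + 1 = 3" by simp
  then show ?thesis unfolding three_eq_0 by (simp add: eq_neg_iff_add_eq_0)
qed

lemma minus_one_minus_one: "- 1 - 1 = (1 :: 'a)"
  by (metis one_plus_one add.inverse_inverse minus_add_distrib uminus_add_conv_diff diff_conv_add_uminus)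

lemma minus_one_neq_one: "(- 1 :: 'a) \<noteq> 1"
proof
  assume "(- 1 :: 'a) = 1"
  then have "(1 + 1 :: 'a) = 0" by (metis add.left_inverse)
  then show False by (simp only: one_plus_one) simp
qed

lemma uminus_neq: "x \<noteq> 0 \<Longrightarrow> - x \<noteq> (x :: 'a)"
  by (metis minus_one_neq_one mult_cancel_right1 mult_minus1)

lemma cube_add: "(x + y :: 'a) ^ 3 = x ^ 3 + y ^ 3"
proof -
  have "(x + y) ^ 3 = x ^ 3 + y ^ 3 + 3 * (x ^ 2 * y + x * y ^ 2)"
    by (simp add: power3_eq_cube power2_eq_square algebra_simps)
  then show ?thesis by (simp add: three_eq_0)
qed

lemma cube_uminus: "(- x :: 'a) ^ 3 = - (x ^ 3)"
  by (simp add: power3_eq_cube)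

text \<open>
  The roots are one of them times the powers of a square root of -1; these are distinct because 2 does
  not vanish in the field.
\<close>

lemma card_fourth_roots:
  assumes "c \<noteq> 0"
  shows "card {x :: 'a. x ^ 4 = c} = 4"
proof -
  obtain r where r: "r ^ 4 = c" using nth_root_exists[of 4 c] by auto
  obtain i where i: "i ^ 2 = (- 1 :: 'a)" using nth_root_exists[of 2 "- 1 :: 'a"] by auto
  have r0: "r \<noteq> 0" using r assms by auto
  have i0: "i \<noteq> 0" using i by auto
  have i1: "i \<noteq> 1" "i \<noteq> - 1" using i minus_one_neq_one by auto
  have "x ^ 4 - c = (x - r) * (x + r) * (x - i * r) * (x + i * r)" for x
  proof -
    have "(x - r) * (x + r) * (x - i * r) * (x + i * r) = (x ^ 2 - r ^ 2) * (x ^ 2 - i ^ 2 * r ^ 2)"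
      by (simp add: power2_eq_square algebra_simps)
    also have "\<dots> = x ^ 4 - r ^ 4" by (simp add: i algebra_simps flip: power_add)
    finally show ?thesis by (simp add: r)
  qed
  then have "x ^ 4 = c \<longleftrightarrow> x = r \<or> x = - r \<or> x = i * r \<or> x = - (i * r)" for x
    using eq_iff_diff_eq_0[of "x ^ 4" c] by (simp add: eq_neg_iff_add_eq_0)
  then have "{x. x ^ 4 = c} = set [r, - r, i * r, - (i * r)]" by auto
  moreover have "distinct [r, - r, i * r, - (i * r)]"
  proof -
    have "- r \<noteq> r" "- (i * r) \<noteq> i * r"
      using uminus_neq[of r] uminus_neq[of "i * r"] r0 i0 by auto
    moreover have "i * r \<noteq> r" "i * r \<noteq> - r"
      using i1 r0 mult_cancel_right[of i r 1] mult_cancel_right[of i r "- 1"] by simp_all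
    moreover have "- (i * r) \<noteq> r"
      using \<open>i * r \<noteq> - r\<close> by (metis add.inverse_inverse)
    ultimately show ?thesis
      unfolding distinct.simps list.set insert_iff neg_equal_iff_equal by (metis empty_iff)
  qed
  ultimately show ?thesis by (simp only: distinct_card) simp
qed

text \<open>Over the integers, \<open>T\<^sup>9 - T = T (T\<^sup>4 - 1) (T\<^sup>4 + 1)\<close>.\<close>

lemma F9_iff: "(x :: 'a) \<in> F9 \<longleftrightarrow> x = 0 \<or> x ^ 4 = 1 \<or> x ^ 4 = - 1"
proof -
  have "x ^ 9 - x = x * ((x ^ 4 - 1) * (x ^ 4 + 1))"
    by (simp add: algebra_simps flip: power_add power_Suc)
  then show ?thesis
    unfolding F9_def by (auto simp: add_eq_0_iff2)
qed

lemma F9_norm: "(x :: 'a) \<in> F9 \<Longrightarrow> x ^ 4 \<in> {0, 1, - 1}"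
  by (auto simp: F9_iff)

lemma card_F9_norm:
  "card {x \<in> F9. x ^ 4 = (0 :: 'a)} = 1"
  "card {x \<in> F9. x ^ 4 = (1 :: 'a)} = 4"
  "card {x \<in> F9. x ^ 4 = (- 1 :: 'a)} = 4"
proof -
  have "{x \<in> F9. x ^ 4 = (0 :: 'a)} = {0}" by (auto simp: F9_iff)
  then show "card {x \<in> F9. x ^ 4 = (0 :: 'a)} = 1" by simp
  have "{x \<in> F9. x ^ 4 = c} = {x. x ^ 4 = c}" if "c \<in> {1, - 1 :: 'a}" for c
    using that by (auto simp: F9_iff)
  then show "card {x \<in> F9. x ^ 4 = (1 :: 'a)} = 4" "card {x \<in> F9. x ^ 4 = (- 1 :: 'a)} = 4"
    using card_fourth_roots[of 1] card_fourth_roots[of "- 1"] by auto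
qed

lemma finite_F9: "finite (F9 :: 'a set)" and card_F9: "card (F9 :: 'a set) = 9"
proof -
  have F9: "(F9 :: 'a set) = insert 0 ({x. x ^ 4 = 1} \<union> {x. x ^ 4 = - 1})"
    by (auto simp: F9_iff)
  have c: "card {x :: 'a. x ^ 4 = 1} = 4" "card {x :: 'a. x ^ 4 = - 1} = 4"
    using card_fourth_roots by auto
  have f: "finite {x :: 'a. x ^ 4 = 1}" "finite {x :: 'a. x ^ 4 = - 1}"
    using c by (auto intro: card_ge_0_finite)
  show "finite (F9 :: 'a set)" unfolding F9 using f by simp
  have "{x :: 'a. x ^ 4 = 1} \<inter> {x. x ^ 4 = - 1} = {}" using minus_one_neq_one by auto
  then show "card (F9 :: 'a set) = 9" unfolding F9 using f c by (simp add: card_Un_disjoint)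
qed

lemma F9_mult: "x \<in> F9 \<Longrightarrow> y \<in> F9 \<Longrightarrow> (x * y :: 'a) \<in> F9"
  by (simp add: F9_def power_mult_distrib)

lemma F9_divide: "x \<in> F9 \<Longrightarrow> y \<in> F9 \<Longrightarrow> (x / y :: 'a) \<in> F9"
  by (simp add: F9_def power_divide)

lemma F9_add: "x \<in> F9 \<Longrightarrow> y \<in> F9 \<Longrightarrow> (x + y :: 'a) \<in> F9"
proof -
  have "z ^ 9 = (z ^ 3) ^ 3" for z :: 'a by (simp flip: power_mult)
  then have "(x + y) ^ 9 = x ^ 9 + y ^ 9" by (simp only: cube_add)
  then show "x \<in> F9 \<Longrightarrow> y \<in> F9 \<Longrightarrow> x + y \<in> F9" by (simp add: F9_def)
qed

lemma F9_0_1: "(0 :: 'a) \<in> F9" "(1 :: 'a) \<in> F9"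
  by (auto simp: F9_def)


section \<open>Counting the points\<close>

lemma card_F9_pairs:
  assumes "c \<in> {0, 1, - 1 :: 'a}"
  shows "card {(x, y) \<in> F9 \<times> F9. x ^ 4 + y ^ 4 = c} = (if c = 0 then 33 else 24)"
proof -
  define S where "S c =
    (\<Sum>d\<in>{0, 1, - 1 :: 'a}. card {x \<in> F9. x ^ 4 = d} * card {y \<in> F9. y ^ 4 = c - d})" for c
  have "card {(x, y) \<in> F9 \<times> F9. x ^ 4 + y ^ 4 = c} = S c"
    unfolding S_def by (rule card_add_fibres) (use F9_norm finite_F9 in auto)
  also have "\<dots> = (if c = 0 then 33 else 24)"
  proof -
    have diffs: "(0 :: 'a) - 0 = 0" "(0 :: 'a) - 1 = - 1" "(0 :: 'a) - - 1 = 1"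
      "(1 :: 'a) - 0 = 1" "(1 :: 'a) - 1 = 0" "(1 :: 'a) - - 1 = - 1"
      "(- 1 :: 'a) - 0 = - 1" "(- 1 :: 'a) - 1 = 1" "(- 1 :: 'a) - - 1 = 0"
      using one_plus_one minus_one_minus_one by simp_all
    have sum3: "(\<Sum>d\<in>{0, 1, - 1 :: 'a}. h d) = h 0 + h 1 + h (- 1)" for h :: "'a \<Rightarrow> nat"
      using minus_one_neq_one by (auto simp: add.assoc)
    have "S 0 = 33" "S 1 = 24" "S (- 1) = 24"
      unfolding S_def sum3 diffs card_F9_norm by simp_all
    then show ?thesis using assms by auto
  qed
  finally show ?thesis .
qed

lemma card_isotropic_F9: "card (isotropic_F9 :: ('a ^ 4) set) = 2240"
proof -
  \<comment> \<open>The four coordinates are grouped as two pairs; the zero vector is among the solutions counted.\<close>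
  define N :: "'a \<times> 'a \<Rightarrow> 'a" where "N = (\<lambda>(x, y). x ^ 4 + y ^ 4)"
  define T where "T = {(p, q) \<in> (F9 \<times> F9) \<times> (F9 \<times> F9). N p + N q = 0}"
  have N: "card {p \<in> F9 \<times> F9. N p = c} = (if c = 0 then 33 else 24)"
    if "c \<in> {0, 1, - 1}" for c
    using card_F9_pairs[OF that] by (simp add: N_def case_prod_unfold mem_Times_iff)
  have N3: "N p \<in> {0, 1, - 1}" if "p \<in> F9 \<times> F9" for p
    using F9_norm[of "fst p"] F9_norm[of "snd p"] that one_plus_one minus_one_minus_one
    by (auto simp: N_def)
  have "card T = (\<Sum>d\<in>{0, 1, - 1}.
      card {p \<in> F9 \<times> F9. N p = d} * card {q \<in> F9 \<times> F9. N q = 0 - d})"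
    unfolding T_def by (rule card_add_fibres) (use N3 finite_F9 in auto)
  also have "\<dots> = 33 * 33 + (24 * 24 + 24 * 24)"
    using minus_one_neq_one by (simp add: N eq_commute[of 1 "- 1"])
  finally have T: "card T = 2241" by simp
  let ?f = "\<lambda>v :: 'a ^ 4. ((v $ 1, v $ 2), (v $ 3, v $ 4))"
  let ?g = "\<lambda>((a, b), (c, d)). \<chi> n :: 4. if n = 1 then a else if n = 2 then b
    else if n = 3 then c else d"
  have "bij_betw ?f (insert 0 isotropic_F9) T"
  proof (rule bij_betwI[where g = ?g])
    show "?f \<in> insert 0 isotropic_F9 \<rightarrow> T"
      using F9_0_1
      by (auto simp: T_def N_def isotropic_F9_def fermat_form_eq_herm[symmetric] sum_4 add.assoc)
    show "?g \<in> T \<rightarrow> insert 0 isotropic_F9"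
      by (auto simp: T_def N_def isotropic_F9_def fermat_form_eq_herm[symmetric] sum_4 add.assoc)
  qed (auto simp: vec_eq_iff forall_4)
  from bij_betw_same_card[OF this]
  have "card (insert 0 (isotropic_F9 :: ('a ^ 4) set)) = 2241" unfolding T .
  moreover from this have "finite (insert 0 (isotropic_F9 :: ('a ^ 4) set))"
    by (intro card_ge_0_finite) simp
  moreover have "(0 :: 'a ^ 4) \<notin> isotropic_F9" by (simp add: isotropic_F9_def)
  ultimately show ?thesis by simp
qed

text \<open>Two rational vectors span the same point iff they differ by one of the 8 rational units.\<close>

lemma card_isotropic_F9_fibre:
  assumes "w \<in> (isotropic_F9 :: ('a ^ 4) set)"
  shows "card {v \<in> isotropic_F9. vec.span {v} = vec.span {w}} = 8"
proof -
  from assms have w: "w \<noteq> 0" "\<forall>i. w $ i \<in> F9" "herm w w = 0" by (auto simp: isotropic_F9_def)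
  from w(1) obtain i where i: "w $ i \<noteq> 0" by (auto simp: vec_eq_iff)
  have "{v \<in> isotropic_F9. vec.span {v} = vec.span {w}} = (\<lambda>c. c *s w) ` (F9 - {0})"
  proof (intro equalityI subsetI)
    fix v assume "v \<in> {v \<in> isotropic_F9. vec.span {v} = vec.span {w}}"
    then have v: "v \<noteq> 0" "\<forall>i. v $ i \<in> F9" "vec.span {v} = vec.span {w}"
      by (auto simp: isotropic_F9_def)
    then obtain c where c: "v = c *s w" by (metis insertI1 span_single_iff vec.span_base)
    then have "c = v $ i / w $ i" using i by simp
    then have "c \<in> F9" using v w F9_divide by blast
    then show "v \<in> (\<lambda>c. c *s w) ` (F9 - {0})" using c v(1) by auto
  next
    fix v assume "v \<in> (\<lambda>c. c *s w) ` (F9 - {0})"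
    then obtain c where c: "v = c *s w" "c \<in> F9" "c \<noteq> 0" by auto
    then have "vec.span {v} = vec.span {w}" by (simp add: span_scale_single)
    moreover have "v \<in> isotropic_F9"
      using c w by (auto simp: isotropic_F9_def F9_mult herm_scale_left herm_scale_right)
    ultimately show "v \<in> {v \<in> isotropic_F9. vec.span {v} = vec.span {w}}" by simp
  qed
  moreover have "inj_on (\<lambda>c. c *s w) (F9 - {0})" using w(1) by (auto simp: inj_on_def)
  ultimately show ?thesis using card_F9 finite_F9 F9_0_1 by (simp add: card_image)
qed

lemma finite_fermat_F9_points: "finite (fermat_F9_points :: ('a ^ 4) set set)"
  and card_fermat_F9_points: "card (fermat_F9_points :: ('a ^ 4) set set) = 280"
proof -
  let ?I = "isotropic_F9 :: ('a ^ 4) set" and ?P = "fermat_F9_points :: ('a ^ 4) set set"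
  have fin: "finite ?I" using card_isotropic_F9 by (intro card_ge_0_finite) simp
  then show "finite ?P" by (simp add: fermat_F9_points_eq)
  have "(\<Sum>v\<in>?I. 1) = (\<Sum>P\<in>?P. \<Sum>v | v \<in> ?I \<and> vec.span {v} = P. (1 :: nat))"
    unfolding fermat_F9_points_eq by (rule sum.image_gen[OF fin])
  also have "\<dots> = (\<Sum>P\<in>?P. 8)"
    by (rule sum.cong) (auto simp: fermat_F9_points_eq card_isotropic_F9_fibre)
  finally show "card ?P = 280" by (simp add: card_isotropic_F9)
qed


section \<open>The points on a line\<close>

lemma herm_add_right: "herm (x :: 'a ^ 4) (y + z) = herm x y + herm x z"
  by (simp add: herm_def sum.distrib cube_add algebra_simps)

text \<open>
  Polarization: expanding \<open>h(a x + y, a x + y) = 0\<close> leaves \<open>a h(x, y) + a\<^sup>3 h(y, x) = 0\<close> for all \<open>a\<close>.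
  This is not identically zero as a polynomial in \<open>a\<close> unless both coefficients vanish, and comparing
  \<open>a = 1\<close> with a square root of -1, for which \<open>a\<^sup>3 = - a\<close>, is enough to see it.
\<close>

lemma fermat_line_isotropic:
  assumes L: "(L :: ('a ^ 4) set) \<in> fermat_lines" and x: "x \<in> L" and y: "y \<in> L"
  shows "herm x y = 0"
proof -
  have sub: "vec.subspace L" and iso: "\<And>x. x \<in> L \<Longrightarrow> herm x x = 0"
    using L by (auto simp: fermat_lines_iff proj_lines_def)
  have *: "a * herm x y + a ^ 3 * herm y x = 0" for a
  proof -
    have "a *s x + y \<in> L" using x y sub by (simp add: vec.subspace_add vec.subspace_scale)
    from iso[OF this] show ?thesis
      by (simp add: herm_add_left herm_add_right herm_scale_left herm_scale_right iso x y add.commute)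
  qed
  obtain i where i: "i ^ 2 = (- 1 :: 'a)" using nth_root_exists[of 2 "- 1 :: 'a"] by auto
  have "herm y x = - herm x y" using *[of 1] by (simp add: eq_neg_iff_add_eq_0 add.commute)
  moreover have "i ^ 3 = - i" using i by (simp add: power3_eq_cube power2_eq_square)
  ultimately have "i * herm x y + i * herm x y = 0" using *[of i] by simp
  then have "- (i * herm x y) = i * herm x y" by (simp add: eq_neg_iff_add_eq_0)
  then have "i * herm x y = 0" using uminus_neq by blast
  then show ?thesis using i by auto
qed

text \<open>
  Up to the order of the coordinates, let \<open>(1, 0, a, b)\<close> and \<open>(0, 1, c, d)\<close> be the echelon basis, and
  \<open>M\<close> the matrix with rows \<open>(a, b)\<close> and \<open>(c, d)\<close>. Write \<open>C\<close> and \<open>N\<close> for the matrices of the cubes and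
  of the ninth powers of its entries. Isotropy says \<open>M C\<^sup>T = - 1\<close>. Transposing gives \<open>C M\<^sup>T = - 1\<close>, and
  cubing the entries gives \<open>C N\<^sup>T = - 1\<close>, so \<open>M = N\<close>.
\<close>

lemma fermat_line_F9_basis:
  fixes L :: "('a ^ 4) set"
  assumes L: "L \<in> fermat_lines"
  obtains u v :: "'a ^ 4" and i j where "L = vec.span {u, v}" "i \<noteq> j"
    "u $ i = 1" "u $ j = 0" "v $ i = 0" "v $ j = 1" "\<forall>n. u $ n \<in> F9" "\<forall>n. v $ n \<in> F9"
proof -
  from L have "L \<in> proj_lines" by (simp add: fermat_lines_iff)
  then obtain u v :: "'a ^ 4" and i j where uv: "L = vec.span {u, v}" "i \<noteq> j"
    "u $ i = 1" "u $ j = 0" "v $ i = 0" "v $ j = 1" by (rule proj_line_echelon_basis)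
  obtain k l where kl: "distinct [i, j, k, l]" "UNIV = {i, j, k, l}"
    by (rule index_complement_pair[OF uv(2)])
  have mem: "u \<in> L" "v \<in> L" by (simp_all add: uv(1) vec.span_base)
  define a b c d where abcd: "a = u $ k" "b = u $ l" "c = v $ k" "d = v $ l"
  have "herm u u = 0" "herm u v = 0" "herm v u = 0" "herm v v = 0"
    using fermat_line_isotropic[OF L] mem by blast+
  then have uu: "1 + a * a ^ 3 + b * b ^ 3 = 0" and uv0: "a * c ^ 3 + b * d ^ 3 = 0"
    and vu: "c * a ^ 3 + d * b ^ 3 = 0" and vv: "1 + c * c ^ 3 + d * d ^ 3 = 0"
    by (simp_all add: herm_expand[OF kl] uv abcd)
  \<comment> \<open>Cramer's rule for the linear system with the cubed coefficients\<close>
  define D where "D = a ^ 3 * d ^ 3 - b ^ 3 * c ^ 3"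
  have solve: "D * x = e * d ^ 3 - b ^ 3 * f" "D * y = a ^ 3 * f - e * c ^ 3"
    if "a ^ 3 * x + b ^ 3 * y = e" "c ^ 3 * x + d ^ 3 * y = f" for x y e f
    unfolding D_def that[symmetric] by (simp_all add: algebra_simps)
  have nine: "x ^ 9 = (x ^ 3) ^ 3" for x :: 'a by (simp flip: power_mult)
  have cubed: "1 + a ^ 3 * a ^ 9 + b ^ 3 * b ^ 9 = 0" "a ^ 3 * c ^ 9 + b ^ 3 * d ^ 9 = 0"
    "c ^ 3 * a ^ 9 + d ^ 3 * b ^ 9 = 0" "1 + c ^ 3 * c ^ 9 + d ^ 3 * d ^ 9 = 0"
    using uu[THEN arg_cong, of "\<lambda>x. x ^ 3"] uv0[THEN arg_cong, of "\<lambda>x. x ^ 3"]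
      vu[THEN arg_cong, of "\<lambda>x. x ^ 3"] vv[THEN arg_cong, of "\<lambda>x. x ^ 3"]
    by (simp_all only: cube_add nine power_mult_distrib power_one power_zero_numeral)
  have e: "a ^ 3 * a + b ^ 3 * b = - 1" "c ^ 3 * a + d ^ 3 * b = 0"
    "a ^ 3 * a ^ 9 + b ^ 3 * b ^ 9 = - 1" "c ^ 3 * a ^ 9 + d ^ 3 * b ^ 9 = 0"
    "a ^ 3 * c + b ^ 3 * d = 0" "c ^ 3 * c + d ^ 3 * d = - 1"
    "a ^ 3 * c ^ 9 + b ^ 3 * d ^ 9 = 0" "c ^ 3 * c ^ 9 + d ^ 3 * d ^ 9 = - 1"
    using uu uv0 vu vv cubed by (simp_all add: eq_neg_iff_add_eq_0 ac_simps)
  note D = solve[OF e(1,2)] solve[OF e(3,4)] solve[OF e(5,6)] solve[OF e(7,8)]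
  have "D \<noteq> 0"
  proof
    assume "D = 0"
    then have "c = 0" "d = 0" using D(1,2) by simp_all
    then show False using vv by simp
  qed
  then have "a \<in> F9 \<and> b \<in> F9 \<and> c \<in> F9 \<and> d \<in> F9"
    using D unfolding F9_def by (metis (mono_tags) mem_Collect_eq mult_left_cancel)
  then have "\<forall>n\<in>{i, j, k, l}. u $ n \<in> F9" "\<forall>n\<in>{i, j, k, l}. v $ n \<in> F9"
    using F9_0_1 uv abcd by auto
  then have "\<forall>n. u $ n \<in> F9" "\<forall>n. v $ n \<in> F9" unfolding kl(2)[symmetric] by simp_all
  with that uv show thesis by blast
qed

text \<open>
  In terms of the rational echelon basis \<open>u, v\<close>, the rational points are spanned by \<open>u + t v\<close> with
  rational \<open>t\<close>, and by \<open>v\<close>.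
\<close>

lemma card_points_on_fermat_line:
  fixes L :: "('a ^ 4) set"
  assumes L: "L \<in> fermat_lines"
  shows "card {P \<in> fermat_F9_points. P \<subseteq> L} = 10"
proof -
  obtain u v :: "'a ^ 4" and i j where uv: "L = vec.span {u, v}" "i \<noteq> j"
    "u $ i = 1" "u $ j = 0" "v $ i = 0" "v $ j = 1" "\<forall>n. u $ n \<in> F9" "\<forall>n. v $ n \<in> F9"
    by (rule fermat_line_F9_basis[OF L])
  have sub: "vec.subspace L" by (simp add: uv(1))
  let ?pt = "\<lambda>t. vec.span {u + t *s v}"
  have "{P \<in> fermat_F9_points. P \<subseteq> L} = insert (vec.span {v}) (?pt ` F9)"
  proof (intro equalityI subsetI)
    fix P assume "P \<in> {P \<in> fermat_F9_points. P \<subseteq> L}"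
    then obtain w :: "'a ^ 4" where w: "P = vec.span {w}" "w \<noteq> 0" "\<forall>n. w $ n \<in> F9" "w \<in> L"
      using sub by (auto simp: fermat_F9_points_eq isotropic_F9_def span_single_subset_iff)
    then obtain a b where ab: "w = a *s u + b *s v" by (auto simp: uv(1) span_pair_iff)
    have F9: "a \<in> F9" "b \<in> F9"
      using w(3)[rule_format, of i] w(3)[rule_format, of j] by (simp_all add: ab uv)
    show "P \<in> insert (vec.span {v}) (?pt ` F9)"
    proof (cases "a = 0")
      case True
      then show ?thesis using w span_scale_single[of b v] by (auto simp: ab)
    next
      case False
      then have "w = a *s (u + (b / a) *s v)" by (simp add: ab vec.scale_right_distrib)
      then have "P = ?pt (b / a)" using span_scale_single[OF False] w(1) by metis
      then show ?thesis using F9_divide F9 by blast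
    qed
  next
    fix P assume "P \<in> insert (vec.span {v}) (?pt ` F9)"
    then obtain w :: "'a ^ 4" where w: "P = vec.span {w}" "w = v \<or> (\<exists>t\<in>F9. w = u + t *s v)" by auto
    then have "w \<in> L" by (auto simp: uv(1) vec.span_base vec.span_add vec.span_scale)
    moreover have "w $ i = 1 \<or> w $ j = 1" using w(2) uv by auto
    then have "w \<noteq> 0" by auto
    moreover have "\<forall>n. w $ n \<in> F9" using w(2) uv(7,8) by (auto intro!: F9_add F9_mult)
    moreover have "herm w w = 0" using fermat_line_isotropic[OF L] \<open>w \<in> L\<close> by blast
    ultimately show "P \<in> {P \<in> fermat_F9_points. P \<subseteq> L}"
      using sub w(1) by (auto simp: fermat_F9_points_eq isotropic_F9_def span_single_subset_iff)
  qed
  moreover have "inj_on ?pt F9"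
  proof (rule inj_onI)
    fix s t assume "?pt s = ?pt t"
    then have "u + s *s v \<in> ?pt t" by (metis insertI1 vec.span_base)
    then obtain c where c: "u + s *s v = c *s (u + t *s v)" by (auto simp: span_single_iff)
    from arg_cong[OF c, of "\<lambda>x. x $ i"] arg_cong[OF c, of "\<lambda>x. x $ j"]
    show "s = t" by (simp add: uv)
  qed
  moreover have "vec.span {v} \<notin> ?pt ` F9"
  proof
    assume "vec.span {v} \<in> ?pt ` F9"
    then obtain t where "vec.span {v} = ?pt t" by auto
    then have "u + t *s v \<in> vec.span {v}" by (metis insertI1 vec.span_base)
    then obtain c where c: "u + t *s v = c *s v" by (auto simp: span_single_iff)
    from arg_cong[OF c, of "\<lambda>x. x $ i"] show False by (simp add: uv)
  qed
  ultimately show ?thesis using finite_F9 card_F9 by (simp add: card_image)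
qed


section \<open>The lines through a point\<close>

text \<open>
  If all partial sums \<open>p\<^sub>i\<^sup>4 + p\<^sub>j\<^sup>4\<close> were 0, then passing through three indices in a cycle would give
  \<open>p\<^sub>i\<^sup>4 = - p\<^sub>i\<^sup>4\<close>. A nonzero partial sum is what makes the form nondegenerate on the part of the
  orthogonal space of \<open>p\<close> that is complementary to \<open>p\<close>.
\<close>

lemma nondegenerate_split:
  fixes p :: "'a ^ 4"
  assumes "p \<noteq> 0"
  obtains i j :: 4 where "i \<noteq> j" "(p $ i) ^ 4 + (p $ j) ^ 4 \<noteq> 0"
proof (rule ccontr)
  assume "\<not> thesis"
  with that have *: "(p $ i) ^ 4 + (p $ j) ^ 4 = 0" if "i \<noteq> j" for i j using that by blast
  have "p $ i = 0" for i
  proof -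
    have "i \<noteq> i + 1" by simp
    moreover obtain k l where "distinct [i, i + 1, k, l]"
      by (rule index_complement_pair[OF calculation])
    ultimately obtain j k where jk: "i \<noteq> j" "i \<noteq> k" "j \<noteq> k" by auto
    have "(p $ i) ^ 4 = - ((p $ i) ^ 4)"
      using *[of i j] *[of i k] *[of j k] jk by (metis add_eq_0_iff2)
    then show ?thesis using uminus_neq[of "(p $ i) ^ 4"] by auto
  qed
  with assms show False by (simp add: vec_eq_iff)
qed

text \<open>
  Let the indices be split as \<open>{i, j}\<close> and \<open>{k, l}\<close> with \<open>s = p\<^sub>i\<^sup>4 + p\<^sub>j\<^sup>4 \<noteq> 0\<close>; then
  \<open>p\<^sub>k\<^sup>4 + p\<^sub>l\<^sup>4 = - s\<close>. In each of the two coordinate planes, turning the cubed coordinates of \<open>p\<close> by a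
  right angle, as in \<open>(p\<^sub>j\<^sup>3, - p\<^sub>i\<^sup>3)\<close>, gives a vector orthogonal to \<open>p\<close>. These two vectors have norms
  \<open>s\<^sup>3\<close> and \<open>- s\<^sup>3\<close>, and together with \<open>p\<close> they span its orthogonal space. Rationality of \<open>p\<close> makes
  orthogonality to \<open>p\<close> symmetric. The isotropic planes containing \<open>p\<close> thus correspond to the combinations
  with coefficients \<open>a, b\<close> for which \<open>s\<^sup>3 (a\<^sup>4 - b\<^sup>4) = 0\<close>, up to scaling.
\<close>

lemma card_fermat_lines_through_point:
  fixes P :: "('a ^ 4) set"
  assumes P: "P \<in> fermat_F9_points"
  shows "card {L \<in> fermat_lines. P \<subseteq> L} = 4"
proof -
  obtain p :: "'a ^ 4" where p: "P = vec.span {p}" "p \<noteq> 0" "\<forall>n. (p $ n) ^ 9 = p $ n" "herm p p = 0"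
    using P by (auto simp: fermat_F9_points_eq isotropic_F9_def F9_def)
  obtain i j where ij: "i \<noteq> j" "(p $ i) ^ 4 + (p $ j) ^ 4 \<noteq> 0"
    by (rule nondegenerate_split[OF p(2)])
  obtain k l where kl: "distinct [i, j, k, l]" "UNIV = {i, j, k, l}"
    by (rule index_complement_pair[OF ij(1)])
  note herm = herm_expand[OF kl]
  have all4: "(\<forall>n. Q n) \<longleftrightarrow> Q i \<and> Q j \<and> Q k \<and> Q l" for Q
    using kl(2) by (metis UNIV_I empty_iff insert_iff)
  define s where "s = (p $ i) ^ 4 + (p $ j) ^ 4"
  have s0: "s \<noteq> 0" using ij by (simp add: s_def)
  have s': "(p $ k) ^ 4 + (p $ l) ^ 4 = - s"
    using p(4) by (simp add: herm s_def eval_nat_numeral algebra_simps eq_neg_iff_add_eq_0)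
  define w where "w a b = (\<chi> n. if n = i then a * (p $ j) ^ 3 else if n = j then - a * (p $ i) ^ 3
    else if n = k then b * (p $ l) ^ 3 else - b * (p $ k) ^ 3)" for a b
  have w: "w a b $ i = a * (p $ j) ^ 3" "w a b $ j = - a * (p $ i) ^ 3"
    "w a b $ k = b * (p $ l) ^ 3" "w a b $ l = - b * (p $ k) ^ 3" for a b
    using kl(1) by (auto simp: w_def)
  have cubes: "((p $ i) ^ 3) ^ 4 + ((p $ j) ^ 3) ^ 4 = s ^ 3"
    "((p $ k) ^ 3) ^ 4 + ((p $ l) ^ 3) ^ 4 = - (s ^ 3)"
    unfolding cube_uminus[symmetric] s'[symmetric]
    by (simp_all add: s_def cube_add flip: power_mult)
  have herm_w: "herm (w a b) (w a b) = s ^ 3 * (a ^ 4 - b ^ 4)" for a b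
  proof -
    have fourth': "x * (x ^ 3 * y) = x ^ 4 * y" for x y :: 'a by (simp add: eval_nat_numeral)
    have "herm (w a b) (w a b) = a ^ 4 * (((p $ i) ^ 3) ^ 4 + ((p $ j) ^ 3) ^ 4)
        + b ^ 4 * (((p $ k) ^ 3) ^ 4 + ((p $ l) ^ 3) ^ 4)"
      by (simp add: herm w power_mult_distrib cube_uminus fourth' algebra_simps)
    then show ?thesis unfolding cubes by (simp add: algebra_simps)
  qed
  have herm_wp: "herm (w a b) p = 0" for a b
    by (simp add: herm w algebra_simps)
  have herm_pw: "herm p (w a b) = 0" for a b
    using p(3) by (simp add: herm w power_mult_distrib cube_uminus algebra_simps flip: power_mult)
  \<comment> \<open>The linear functionals f and g vanish at p and recover the coefficients a and b, up to
    the factors s and - s.\<close>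
  define f where "f x = x $ i * p $ j - x $ j * p $ i" for x :: "'a ^ 4"
  define g where "g x = x $ k * p $ l - x $ l * p $ k" for x :: "'a ^ 4"
  have fourth: "x ^ 3 * x = x ^ 4" for x :: 'a by (simp add: eval_nat_numeral)
  have f: "f p = 0" "f (c *s x) = c * f x" "f (x + y) = f x + f y" for c x y
    by (simp_all add: f_def algebra_simps)
  have g: "g p = 0" "g (c *s x) = c * g x" "g (x + y) = g x + g y" for c x y
    by (simp_all add: g_def algebra_simps)
  have fw: "f (w a b) = a * s" for a b
    by (simp add: f_def w s_def mult.assoc fourth distrib_left add.commute)
  have gw: "g (w a b) = - (b * s)" for a b
    unfolding mult_minus_right[symmetric] s'[symmetric]
    by (simp add: g_def w mult.assoc fourth distrib_left add.commute)
  have perp: "\<exists>c a b. q = c *s p + w a b" if q: "herm q p = 0" for q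
  proof -
    define c a b where "c = (q $ i * (p $ i) ^ 3 + q $ j * (p $ j) ^ 3) / s"
      and "a = f q / s" and "b = - g q / s"
    then have cs: "c * s = q $ i * (p $ i) ^ 3 + q $ j * (p $ j) ^ 3"
      and as: "a * s = f q" and bs: "b * s = - g q" using s0 by simp_all
    \<comment> \<open>Orthogonality to p makes the two halves of q agree on the coefficient of p.\<close>
    have cs': "c * s = - (q $ k * (p $ k) ^ 3 + q $ l * (p $ l) ^ 3)"
      using q unfolding cs eq_neg_iff_add_eq_0 by (simp add: herm add.assoc)
    have "s * q $ n = s * (c *s p + w a b) $ n" for n
    proof -
      have s'': "s = - ((p $ k) ^ 4 + (p $ l) ^ 4)" using s' by simp
      have "s * q $ i = (c * s) * p $ i + (a * s) * (p $ j) ^ 3"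
        "s * q $ j = (c * s) * p $ j - (a * s) * (p $ i) ^ 3"
        unfolding cs as f_def unfolding s_def by (simp_all add: eval_nat_numeral algebra_simps)
      moreover have "s * q $ k = (c * s) * p $ k + (b * s) * (p $ l) ^ 3"
        "s * q $ l = (c * s) * p $ l - (b * s) * (p $ k) ^ 3"
        unfolding cs' bs g_def unfolding s'' by (simp_all add: eval_nat_numeral algebra_simps)
      ultimately have "\<forall>n. s * q $ n = s * (c *s p + w a b) $ n"
        unfolding all4 by (simp add: w algebra_simps)
      then show ?thesis by blast
    qed
    then have "q = c *s p + w a b" using s0 by (simp add: vec_eq_iff)
    then show ?thesis by blast
  qed
  have p_in: "p \<in> L" if "P \<subseteq> L" for L using that p(1) by (auto intro: vec.span_base)
  have indep: "w z 1 \<notin> vec.span {p}" for z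
  proof
    assume "w z 1 \<in> vec.span {p}"
    then obtain c where c: "w z 1 = c *s p" by (auto simp: span_single_iff)
    from arg_cong[OF c, of g] show False using s0 by (simp add: g gw)
  qed
  have "{L \<in> fermat_lines. P \<subseteq> L} = (\<lambda>z. vec.span {p, w z 1}) ` {z. z ^ 4 = 1}"
  proof (intro equalityI subsetI)
    fix L assume "L \<in> {L \<in> fermat_lines. P \<subseteq> L}"
    then have L: "L \<in> fermat_lines" "p \<in> L" using p_in by auto
    then have pl: "L \<in> proj_lines" and sub: "vec.subspace L"
      by (auto simp: fermat_lines_iff proj_lines_def)
    obtain q where q: "q \<in> L" "q \<notin> vec.span {p}" by (rule proj_line_obtain_second[OF pl])
    obtain c a b where cab: "q = c *s p + w a b"
      using perp[of q] fermat_line_isotropic[OF L(1) q(1) L(2)] by blast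
    then have "w a b = q - c *s p" by simp
    then have wL: "w a b \<in> L" using q L sub by (simp add: vec.subspace_diff vec.subspace_scale)
    have "herm (w a b) (w a b) = 0" by (rule fermat_line_isotropic[OF L(1) wL wL])
    then have ab: "a ^ 4 = b ^ 4" using s0 by (simp add: herm_w)
    have b0: "b \<noteq> 0"
    proof
      assume "b = 0"
      then have "w a b = 0" using ab by (simp add: vec_eq_iff all4 w)
      then show False using q(2) cab by (auto simp: span_single_iff)
    qed
    have "w (a / b) 1 = inverse b *s w a b" using b0 by (simp add: vec_eq_iff all4 w field_simps)
    then have "w (a / b) 1 \<in> L" using wL sub by (simp add: vec.subspace_scale)
    then have "L = vec.span {p, w (a / b) 1}"
      using proj_line_eq_span[OF pl L(2) _ p(2) indep] by blast
    moreover have "(a / b) ^ 4 = 1" using ab b0 by (simp add: power_divide)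
    ultimately show "L \<in> (\<lambda>z. vec.span {p, w z 1}) ` {z. z ^ 4 = 1}" by blast
  next
    fix L assume "L \<in> (\<lambda>z. vec.span {p, w z 1}) ` {z. z ^ 4 = 1}"
    then obtain z where z: "z ^ 4 = 1" "L = vec.span {p, w z 1}" by auto
    have "L \<in> proj_lines" using span_pair_proj_lines[OF p(2) indep] z by simp
    moreover have "herm x x = 0" if "x \<in> L" for x
      using that z by (auto simp: span_pair_iff herm_add_left herm_add_right herm_scale_left
          herm_scale_right p(4) herm_w herm_wp herm_pw)
    moreover have "P \<subseteq> L" unfolding p(1) z(2) by (rule vec.span_mono) simp
    ultimately show "L \<in> {L \<in> fermat_lines. P \<subseteq> L}" by (simp add: fermat_lines_iff)
  qed
  moreover have "inj_on (\<lambda>z. vec.span {p, w z 1}) {z. z ^ 4 = 1}"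
  proof (rule inj_onI)
    fix y z assume "vec.span {p, w y 1} = vec.span {p, w z 1}"
    then have "w y 1 \<in> vec.span {p, w z 1}" by (metis insertCI vec.span_base)
    then obtain a b where ab: "w y 1 = a *s p + b *s w z 1" by (auto simp: span_pair_iff)
    from arg_cong[OF ab, of g] arg_cong[OF ab, of f] show "y = z" using s0 by (simp add: f g fw gw)
  qed
  ultimately show ?thesis by (simp add: card_image card_fourth_roots)
qed


section \<open>The configuration\<close>

text \<open>
  Each line contains a rational point, so the set of lines is a union of the 280 four-element sets of
  lines through the points. It is therefore finite, and double counting applies.
\<close>

lemma card_fermat_lines: "card (fermat_lines :: ('a ^ 4) set set) = 112"
proof -
  let ?P = "fermat_F9_points :: ('a ^ 4) set set" and ?L = "fermat_lines :: ('a ^ 4) set set"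
  have "?L \<subseteq> (\<Union>P\<in>?P. {L \<in> ?L. P \<subseteq> L})"
  proof
    fix L assume L: "L \<in> ?L"
    then have "{P \<in> ?P. P \<subseteq> L} \<noteq> {}" using card_points_on_fermat_line[OF L] by force
    then show "L \<in> (\<Union>P\<in>?P. {L \<in> ?L. P \<subseteq> L})" using L by blast
  qed
  moreover have "finite {L \<in> ?L. P \<subseteq> L}" if "P \<in> ?P" for P
    using card_fermat_lines_through_point[OF that] by (intro card_ge_0_finite) simp
  ultimately have "finite ?L" using finite_fermat_F9_points by (meson finite_UN finite_subset)
  then have "(\<Sum>P\<in>?P. card {L \<in> ?L. P \<subseteq> L}) = 10 * card ?L"
    using finite_fermat_F9_points card_points_on_fermat_line by (intro sum_multicount) auto
  then show ?thesis by (simp add: card_fermat_lines_through_point card_fermat_F9_points)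
qed

end

theorem proposition3p1:
  assumes "CHAR('a::alg_closed_field) = 3"
  shows "card (fermat_F9_points :: ('a ^ 4) set set) = 280
    \<and> card (fermat_lines :: ('a ^ 4) set set) = 112
    \<and> (\<forall>L \<in> (fermat_lines :: ('a ^ 4) set set). card {P \<in> fermat_F9_points. P \<subseteq> L} = 10)
    \<and> (\<forall>P \<in> (fermat_F9_points :: ('a ^ 4) set set). card {L \<in> fermat_lines. P \<subseteq> L} = 4)"
  using card_fermat_F9_points[OF assms] card_fermat_lines[OF assms]
    card_points_on_fermat_line[OF assms] card_fermat_lines_through_point[OF assms] by blast

end
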